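(* Suppose all access costs $c_j$, $j\in N_x$, are integers, and let $M=\min\{\sum_{j\in N_x}c_j,\ \beta\}$. When $A_{\mathrm{Knap}}$ is the pseudo-polynomial algorithm that finds an optimal solution to the Knapsack problem over $n$ items with budget $B$ in time $O(nB)$, algorithm $\mathrm{DS}_{\mathrm{PP}}$ (described in the context) is a pseudo-polynomial algorithm that finds an optimal solution to the Data Store Selection problem in time $O(n_xM^2)$.
   Context: $N_x$ is a finite set of $n_x$ data stores; each $j\in N_x$ has an access cost $c_j\ge 1$ and a misindication ratio $\rho_j\in[0,1]$; $\beta\ge 1$ is the miss penalty. For $D\subseteq N_x$ the expected cost is $\phi(D)=\sum_{j\in D}c_j+\beta\prod_{j\in D}\rho_j$ (empty sum $0$, empty product $1$). The Data Store Selection (DSS) problem is to find $D\subseteq N_x$ minimizing $\phi(D)$. Knapsack: in the $(B,U,\pi,\gamma)$-Knapsack problem one is given a budget $B$ and a set $U$ of items, item $j$ having profit $\pi_j$ and cost $\gamma_j$; the goal is a set $S\subseteq U$ with $\sum_{j\in S}\gamma_j\le B$ maximizing $\sum_{j\in S}\pi_j$. $A_{\mathrm{Knap}}(B,U,\pi,\gamma)$ denotes the set output by a Knapsack algorithm $A_{\mathrm{Knap}}$. Algorithm $\mathrm{DS}_{\mathrm{PP}}$: set $w_j=-\log\rho_j$ for $j\in N_x$ (logarithms are base 2, $-\log 0=+\infty$); for every integer $B\in\{0,1,\dots,M\}$ (i.e. $0\le B\le M$) compute $D_B=A_{\mathrm{Knap}}(B,N_x,w,c)$; return the $D_B$ minimizing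 $\phi(D_B)$. *)

theory Defs
  imports
    Complex_Main
    "HOL-Library.Extended_Real"
    "HOL-Library.Landau_Symbols"
    "HOL-Library.Monad_Syntax"
begin

text \<open>
  Finite sets of data stores (and of Knapsack items) are given to algorithms as duplicate-free
  lists.
\<close>

record 'a dss =
  stores :: "'a list"
  acc_cost :: "'a \<Rightarrow> real"
  misind :: "'a \<Rightarrow> real"
  penalty :: real

definition dss_instance :: "'a dss \<Rightarrow> bool" where
  "dss_instance I \<longleftrightarrow>
     distinct (stores I) \<and>
     (\<forall>j\<in>set (stores I). 1 \<le> acc_cost I j \<and> 0 \<le> misind I j \<and> misind I j \<le> 1) \<and>
     1 \<le> penalty I"

definition integer_costs :: "'a dss \<Rightarrow> bool" where
  "integer_costs I \<longleftrightarrow> (\<forall>j\<in>set (stores I). acc_cost I j \<in> \<int>)"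

definition phi :: "'a dss \<Rightarrow> 'a set \<Rightarrow> real" where
  "phi I D = (\<Sum>j\<in>D. acc_cost I j) + penalty I * (\<Prod>j\<in>D. misind I j)"

definition dss_optimal :: "'a dss \<Rightarrow> 'a set \<Rightarrow> bool" where
  "dss_optimal I D \<longleftrightarrow>
     D \<subseteq> set (stores I) \<and> (\<forall>D'\<subseteq>set (stores I). phi I D \<le> phi I D')"

definition max_budget :: "'a dss \<Rightarrow> real" where
  "max_budget I = min (\<Sum>j\<in>set (stores I). acc_cost I j) (penalty I)"

text \<open>Profits are extended reals because a store with misindication ratio 0 yields profit \<open>\<infinity>\<close>.\<close>

record 'a knapsack =
  budget :: nat
  items :: "'a list"
  profit :: "'a \<Rightarrow> ereal"
  item_cost :: "'a \<Rightarrow> real"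

definition knapsack_instance :: "'a knapsack \<Rightarrow> bool" where
  "knapsack_instance K \<longleftrightarrow>
     distinct (items K) \<and>
     (\<forall>j\<in>set (items K). 0 \<le> profit K j \<and> item_cost K j \<in> \<int> \<and> 1 \<le> item_cost K j)"

definition knapsack_feasible :: "'a knapsack \<Rightarrow> 'a set \<Rightarrow> bool" where
  "knapsack_feasible K S \<longleftrightarrow> S \<subseteq> set (items K) \<and> (\<Sum>j\<in>S. item_cost K j) \<le> real (budget K)"

definition knapsack_optimal :: "'a knapsack \<Rightarrow> 'a set \<Rightarrow> bool" where
  "knapsack_optimal K S \<longleftrightarrow>
     knapsack_feasible K S \<and>
     (\<forall>S'. knapsack_feasible K S' \<longrightarrow> (\<Sum>j\<in>S'. profit K j) \<le> (\<Sum>j\<in>S. profit K j))"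

text \<open>
  Algorithms are programs in a step-counting monad. The machine model is the unit-cost real RAM
  with random-access arrays (represented as functions): every arithmetic operation, logarithm,
  comparison, array allocation, array access and array update takes one step. A subroutine such as the
  Knapsack algorithm contributes the number of steps it reports itself.
\<close>

datatype 'b timed = Timed (result: 'b) (steps: nat)

definition return :: "'b \<Rightarrow> 'b timed" where
  "return x = Timed x 0"

definition bind_timed :: "'b timed \<Rightarrow> ('b \<Rightarrow> 'c timed) \<Rightarrow> 'c timed" where
  "bind_timed p f = Timed (result (f (result p))) (steps p + steps (f (result p)))"

lemma bind_timed_cong [fundef_cong]:
  "p = q \<Longrightarrow> (\<And>x. x = result q \<Longrightarrow> f x = g x) \<Longrightarrow> bind_timed p f = bind_timed q g"
  by (simp add: bind_timed_def)

adhoc_overloading Monad_Syntax.bind \<rightleftharpoons> bind_timed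

definition op1 :: "'b \<Rightarrow> 'b timed" where
  "op1 x = Timed x 1"

text \<open>
  An \<open>O\<close>-bound over all members of a set \<open>X\<close> of inputs is \<open>O[principal X]\<close>: one constant works
  for every input in \<open>X\<close>.

  The maxima only matter for \<open>n = 0\<close> or \<open>B = 0\<close>, where \<open>n B = 0\<close> would force the
  algorithm to take no step at all.
\<close>

definition optimal_knapsack_alg_nB :: "('a knapsack \<Rightarrow> 'a list timed) \<Rightarrow> bool" where
  "optimal_knapsack_alg_nB A \<longleftrightarrow>
     (\<forall>K. knapsack_instance K \<longrightarrow>
        distinct (result (A K)) \<and> knapsack_optimal K (set (result (A K)))) \<and>
     (\<lambda>K. real (steps (A K)))
       \<in> O[principal {K. knapsack_instance K}](
           \<lambda>K. real (max 1 (length (items K)) * max 1 (budget K)))"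

text \<open>
  Pseudo-polynomial: bounded by a polynomial in the length of the input and the largest number
  occurring in it. An instance with \<open>n\<close> stores consists of \<open>2 n + 1\<close> numbers; the ratios are at
  most 1 and hence never exceed the penalty.
\<close>

definition max_number :: "'a dss \<Rightarrow> real" where
  "max_number I = Max (insert (penalty I) (acc_cost I ` set (stores I)))"

definition pseudo_polynomial_on :: "'a dss set \<Rightarrow> ('a dss \<Rightarrow> 'b timed) \<Rightarrow> bool" where
  "pseudo_polynomial_on X A \<longleftrightarrow>
     (\<exists>k. (\<lambda>I. real (steps (A I)))
        \<in> O[principal X](\<lambda>I. (real (2 * length (stores I) + 1) * max_number I) ^ k))"

definition neg_log :: "real \<Rightarrow> ereal" where
  "neg_log r = (if r = 0 then \<infinity> else ereal (- log 2 r))"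

fun compute_weights :: "('a \<Rightarrow> real) \<Rightarrow> 'a list \<Rightarrow> ('a \<Rightarrow> ereal) timed" where
  "compute_weights \<rho> [] = op1 (\<lambda>_. 0)"
| "compute_weights \<rho> (j # js) = do {
     w \<leftarrow> compute_weights \<rho> js;
     r \<leftarrow> op1 (\<rho> j);
     x \<leftarrow> op1 (neg_log r);
     op1 (w(j := x))
   }"

fun compute_sum :: "('a \<Rightarrow> real) \<Rightarrow> 'a list \<Rightarrow> real timed" where
  "compute_sum f [] = op1 0"
| "compute_sum f (j # js) = do {
     s \<leftarrow> compute_sum f js;
     x \<leftarrow> op1 (f j);
     op1 (x + s)
   }"

fun compute_prod :: "('a \<Rightarrow> real) \<Rightarrow> 'a list \<Rightarrow> real timed" where
  "compute_prod f [] = op1 1"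
| "compute_prod f (j # js) = do {
     p \<leftarrow> compute_prod f js;
     x \<leftarrow> op1 (f j);
     op1 (x * p)
   }"

definition compute_phi :: "'a dss \<Rightarrow> 'a list \<Rightarrow> real timed" where
  "compute_phi I D = do {
     s \<leftarrow> compute_sum (acc_cost I) D;
     p \<leftarrow> compute_prod (misind I) D;
     q \<leftarrow> op1 (penalty I * p);
     op1 (s + q)
   }"

definition compute_max_budget :: "'a dss \<Rightarrow> real timed" where
  "compute_max_budget I = do {
     s \<leftarrow> compute_sum (acc_cost I) (stores I);
     op1 (min s (penalty I))
   }"

definition knapsack_of :: "'a dss \<Rightarrow> ('a \<Rightarrow> ereal) \<Rightarrow> nat \<Rightarrow> 'a knapsack" where
  "knapsack_of I w B = \<lparr>budget = B, items = stores I, profit = w, item_cost = acc_cost I\<rparr>"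

text \<open>
  The pair \<open>(D, v)\<close> is the best candidate so far with its expected cost. The bound \<open>M\<close> is a real
  number because the penalty need not be an integer. The step of the loop test \<open>B \<le> M\<close> is charged in
  the branches, as \<open>op1 True\<close> and \<open>op1 False\<close>. Budget 0 is handled before the loop.
\<close>

function ds_loop ::
  "('a knapsack \<Rightarrow> 'a list timed) \<Rightarrow> 'a dss \<Rightarrow> ('a \<Rightarrow> ereal) \<Rightarrow> real \<Rightarrow> nat
     \<Rightarrow> 'a list \<times> real \<Rightarrow> 'a list timed" where
  "ds_loop A I w M B (D, v) =
     (if real B \<le> M then do {
        op1 True;
        D' \<leftarrow> A (knapsack_of I w B);
        v' \<leftarrow> compute_phi I D';
        better \<leftarrow> op1 (v' < v);
        B' \<leftarrow> op1 (B + 1);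
        ds_loop A I w M B' (if better then (D', v') else (D, v))
      }
      else do {
        op1 False;
        return D
      })"
  by pat_completeness auto
termination
  by (relation "measure (\<lambda>(A, I, w, M, B, D, v). nat (\<lfloor>M\<rfloor> + 1 - int B))")
    (auto simp: op1_def le_floor_iff)

definition ds_pp :: "('a knapsack \<Rightarrow> 'a list timed) \<Rightarrow> 'a dss \<Rightarrow> 'a list timed" where
  "ds_pp A I = do {
     M \<leftarrow> compute_max_budget I;
     w \<leftarrow> compute_weights (misind I) (stores I);
     D\<^sub>0 \<leftarrow> A (knapsack_of I w 0);
     v\<^sub>0 \<leftarrow> compute_phi I D\<^sub>0;
     ds_loop A I w M 1 (D\<^sub>0, v\<^sub>0)
   }"

end

theory Submission
  imports Defs
begin

text \<open>
  The profit of a set in the Knapsack instances is the negated logarithm of its misindication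
  product, so a set that is optimal for budget \<open>B\<close> has the least product among all sets of cost at
  most \<open>B\<close>. Let \<open>D'\<close> be any set of stores, of integer cost \<open>C\<close>. If \<open>C \<le> M\<close>, the candidate for
  budget \<open>C\<close> is at least as good as \<open>D'\<close>. If \<open>C > M\<close>, then \<open>M\<close> is the penalty, and the candidate for
  budget 0, which is the empty set, has expected cost \<open>\<beta> = M < C \<le> \<phi>(D')\<close>.

  At most \<open>M\<close> iterations are executed after the one for budget 0, each in time \<open>O(n M)\<close>.
\<close>

section \<open>Results and step counts of the elementary programs\<close>

lemma result_bind_timed [simp]: "result (bind_timed p f) = result (f (result p))"
  and steps_bind_timed [simp]: "steps (bind_timed p f) = steps p + steps (f (result p))"
  by (simp_all add: bind_timed_def)

lemma result_op1 [simp]: "result (op1 x) = x"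
  and steps_op1 [simp]: "steps (op1 x) = 1"
  by (simp_all add: op1_def)

lemma result_return [simp]: "result (return x) = x"
  and steps_return [simp]: "steps (return x) = 0"
  by (simp_all add: return_def)

lemma result_compute_sum: "result (compute_sum f xs) = sum_list (map f xs)"
  by (induction xs) auto

lemma steps_compute_sum: "steps (compute_sum f xs) = 1 + 2 * length xs"
  by (induction xs) auto

lemma result_compute_prod: "result (compute_prod f xs) = prod_list (map f xs)"
  by (induction xs) auto

lemma steps_compute_prod: "steps (compute_prod f xs) = 1 + 2 * length xs"
  by (induction xs) auto

lemma result_compute_weights:
  "result (compute_weights \<rho> xs) j = (if j \<in> set xs then neg_log (\<rho> j) else 0)"
  by (induction xs) auto

lemma steps_compute_weights: "steps (compute_weights \<rho> xs) = 1 + 3 * length xs"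
  by (induction xs) auto

text \<open>The program traverses the list while \<open>phi\<close> ranges over the set, so a
  repeated store would be counted twice.\<close>

lemma result_compute_phi:
  assumes "distinct D"
  shows "result (compute_phi I D) = phi I (set D)"
  using assms
  by (simp add: compute_phi_def phi_def result_compute_sum result_compute_prod
      sum_list_distinct_conv_sum_set prod.distinct_set_conv_list)

lemma steps_compute_phi: "steps (compute_phi I D) = 4 + 4 * length D"
  by (simp add: compute_phi_def steps_compute_sum steps_compute_prod)

lemma result_compute_max_budget:
  assumes "distinct (stores I)"
  shows "result (compute_max_budget I) = max_budget I"
  using assms
  by (simp add: compute_max_budget_def max_budget_def result_compute_sum
      sum_list_distinct_conv_sum_set)

lemma steps_compute_max_budget: "steps (compute_max_budget I) = 2 + 2 * length (stores I)"
  by (simp add: compute_max_budget_def steps_compute_sum)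

section \<open>The negated logarithm with values in the extended reals\<close>

lemma neg_log_nonneg:
  assumes "0 \<le> r" "r \<le> 1"
  shows "0 \<le> neg_log r"
  using assms by (auto simp: neg_log_def)

text \<open>A zero factor makes both sides \<infinity>: \<open>neg_log\<close> is never -\<infinity>
  here, so \<infinity> absorbs the other summand.\<close>

lemma neg_log_mult:
  assumes "0 \<le> x" "0 \<le> y"
  shows "neg_log (x * y) = neg_log x + neg_log y"
  using assms by (auto simp: neg_log_def log_mult)

lemma neg_log_prod:
  assumes "\<And>j. j \<in> S \<Longrightarrow> 0 \<le> \<rho> j"
  shows "neg_log (\<Prod>j\<in>S. \<rho> j) = (\<Sum>j\<in>S. neg_log (\<rho> j))"
  using assms
proof (induction S rule: infinite_finite_induct)
  case (insert x F)
  then show ?case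
    by (simp add: neg_log_mult prod_nonneg)
\<comment> \<open>For infinite \<open>S\<close>, as for the empty set, the product defaults to 1 and
  the sum to 0, and \<open>neg_log 1 = 0\<close>.\<close>
qed (auto simp: neg_log_def zero_ereal_def)

text \<open>The order reversal extends to ratio 0, the least argument, whose value \<infinity> is
  the greatest.\<close>

lemma neg_log_le_iff:
  assumes "0 \<le> x" "0 \<le> y"
  shows "neg_log x \<le> neg_log y \<longleftrightarrow> y \<le> x"
  using assms by (auto simp: neg_log_def)

section \<open>The loop over the budgets\<close>

declare ds_loop.simps [simp del]

text \<open>Guarded by the loop test, the recursive equation unfolds just one iteration. The 3
  counts the test, the comparison and the increment.\<close>

lemma ds_loop_continue:
  assumes "real B \<le> M"
  shows "result (ds_loop A I w M B (D, v)) =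
           (let D' = result (A (knapsack_of I w B)); v' = result (compute_phi I D')
            in result (ds_loop A I w M (Suc B) (if v' < v then (D', v') else (D, v))))"
    and "steps (ds_loop A I w M B (D, v)) =
           (let D' = result (A (knapsack_of I w B)); v' = result (compute_phi I D')
            in 3 + steps (A (knapsack_of I w B)) + steps (compute_phi I D')
               + steps (ds_loop A I w M (Suc B) (if v' < v then (D', v') else (D, v))))"
  using assms by (subst ds_loop.simps, simp add: Let_def)+

lemma ds_loop_stop:
  assumes "\<not> real B \<le> M"
  shows "result (ds_loop A I w M B (D, v)) = D"
    and "steps (ds_loop A I w M B (D, v)) = 1"
  using assms by (simp_all add: ds_loop.simps)

text \<open>The invariant is that \<open>v\<close> is the expected cost of \<open>D\<close>. A
  replacement happens only when it lowers this cost, and every remaining budget gets its turn. That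
  the output is one of the candidates will show that it consists of stores.\<close>

lemma result_ds_loop:
  fixes A :: "'a knapsack \<Rightarrow> 'a list timed" and M :: real and B :: nat and D :: "'a list"
  assumes "\<And>B. distinct (result (A (knapsack_of I w B)))"
  defines "R \<equiv> \<lambda>B. set (result (A (knapsack_of I w B)))"
  assumes "v = phi I (set D)"
  defines "E \<equiv> set (result (ds_loop A I w M B (D, v)))"
  shows "(E = set D \<or> E \<in> range R) \<and> phi I E \<le> phi I (set D) \<and>
    (\<forall>B'\<ge>B. real B' \<le> M \<longrightarrow> phi I E \<le> phi I (R B'))"
  using assms(3) unfolding E_def
\<comment> \<open>The measure counts the budgets from \<open>B\<close> to \<lfloor>M\<rfloor>; it is
  0 exactly when the loop test fails.\<close>
proof (induction "nat (\<lfloor>M\<rfloor> + 1 - int B)" arbitrary: B D v)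
  case 0
  then have stop: "\<not> real B \<le> M" by (simp add: le_floor_iff) linarith
  then have "\<not> real B' \<le> M" if "B' \<ge> B" for B'
    using that by linarith
  then show ?case using stop by (auto simp: ds_loop_stop)
next
  case (Suc k)
  then have continue: "real B \<le> M" by linarith
  define D' where "D' = result (A (knapsack_of I w B))"
  have v': "result (compute_phi I D') = phi I (set D')"
    unfolding D'_def by (rule result_compute_phi) (rule assms(1))
  \<comment> \<open>By the invariant, the next state is \<open>D''\<close> paired with its own
    expected cost, whichever branch is taken, so the induction hypothesis applies to it.\<close>
  define D'' where "D'' = (if phi I (set D') < v then D' else D)"
  define E' where "E' = set (result (ds_loop A I w M (Suc B) (D'', phi I (set D''))))"
  have E': "set (result (ds_loop A I w M B (D, v))) = E'"
    using Suc.prems by (simp add: ds_loop_continue[OF continue] D'_def[symmetric] Let_def v' E'_def D''_def)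
  have IH: "(E' = set D'' \<or> E' \<in> range R) \<and> phi I E' \<le> phi I (set D'') \<and>
    (\<forall>B'\<ge>Suc B. real B' \<le> M \<longrightarrow> phi I E' \<le> phi I (R B'))"
    unfolding E'_def by (rule Suc.hyps(1)) (use Suc.hyps(2) in linarith, simp)
  have RB: "R B = set D'" by (simp add: R_def D'_def)
  have le: "phi I (set D'') \<le> phi I (set D)" "phi I (set D'') \<le> phi I (R B)"
    using Suc.prems by (auto simp: D''_def RB)
  have "E' = set D \<or> E' \<in> range R"
    using IH RB by (metis D''_def rangeI)
  moreover have "phi I E' \<le> phi I (R B')" if "B' \<ge> B" "real B' \<le> M" for B'
    using that IH le(2) by (cases "B' = B") auto
  ultimately show ?case
    unfolding E' using IH le(1) by auto
qed

text \<open>\<open>T\<close> covers the Knapsack call and the evaluation of its output, 3 the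
  remaining steps of an iteration, and the leading 1 the failing test. Only budgets up to
  \<open>M\<close> must obey \<open>T\<close>, as Knapsack time may grow with the budget.\<close>

lemma steps_ds_loop:
  assumes "\<And>B'. real B' \<le> M \<Longrightarrow>
    real (steps (A (knapsack_of I w B')))
      + real (steps (compute_phi I (result (A (knapsack_of I w B'))))) \<le> T"
  shows "real (steps (ds_loop A I w M B (D, v))) \<le> 1 + real (nat (\<lfloor>M\<rfloor> + 1 - int B)) * (T + 3)"
proof (induction "nat (\<lfloor>M\<rfloor> + 1 - int B)" arbitrary: B D v)
  case 0
  then have stop: "\<not> real B \<le> M" by (simp add: le_floor_iff) linarith
  then show ?case using 0 by (simp add: ds_loop_stop)
next
  case (Suc k)
  then have continue: "real B \<le> M" by linarith
  define D' where "D' = result (A (knapsack_of I w B))"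
  define v' where "v' = result (compute_phi I D')"
  obtain D2 v2 where D2: "(if v' < v then (D', v') else (D, v)) = (D2, v2)"
    by fastforce
  have k: "k = nat (\<lfloor>M\<rfloor> + 1 - int (Suc B))"
    using Suc.hyps(2) by linarith
  have "real (steps (ds_loop A I w M (Suc B) (D2, v2))) \<le> 1 + real k * (T + 3)"
    using Suc.hyps(1)[OF k, of D2 v2] k by simp
  moreover have "steps (ds_loop A I w M B (D, v)) = 3 + steps (A (knapsack_of I w B))
      + steps (compute_phi I D') + steps (ds_loop A I w M (Suc B) (D2, v2))"
    using D2
    by (auto simp: ds_loop_continue(2)[OF continue] D'_def[symmetric] v'_def[symmetric] Let_def
        split: if_splits)
  moreover have "real (steps (A (knapsack_of I w B))) + real (steps (compute_phi I D')) \<le> T"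
    using assms[OF continue] by (simp add: D'_def)
  ultimately show ?case
    unfolding Suc.hyps(2)[symmetric] by (simp add: algebra_simps)
qed

section \<open>Data store selection through Knapsack solutions\<close>

abbreviation dss_weights :: "'a dss \<Rightarrow> 'a \<Rightarrow> ereal" where
  "dss_weights I \<equiv> result (compute_weights (misind I) (stores I))"

lemma knapsack_instance_of_dss:
  assumes "dss_instance I" "integer_costs I"
  shows "knapsack_instance (knapsack_of I (dss_weights I) B)"
  using assms
  by (auto simp: knapsack_instance_def knapsack_of_def dss_instance_def integer_costs_def
      result_compute_weights neg_log_nonneg)

lemma knapsack_feasible_of_dss_iff:
  "knapsack_feasible (knapsack_of I w B) S \<longleftrightarrow>
     S \<subseteq> set (stores I) \<and> (\<Sum>j\<in>S. acc_cost I j) \<le> real B"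
  by (simp add: knapsack_feasible_def knapsack_of_def)

text \<open>On sets of stores the profit is \<open>neg_log\<close> of the product, and
  \<open>neg_log\<close> reverses the order, so the largest profit gives the least product.\<close>

lemma knapsack_optimal_min_prod:
  assumes I: "dss_instance I"
    and opt: "knapsack_optimal (knapsack_of I (dss_weights I) B) S"
    and S': "S' \<subseteq> set (stores I)" "(\<Sum>j\<in>S'. acc_cost I j) \<le> real B"
  shows "(\<Prod>j\<in>S. misind I j) \<le> (\<Prod>j\<in>S'. misind I j)"
proof -
  have S: "S \<subseteq> set (stores I)"
    using opt by (simp add: knapsack_optimal_def knapsack_feasible_of_dss_iff)
  have nonneg: "0 \<le> misind I j" if "j \<in> set (stores I)" for j
    using I that by (auto simp: dss_instance_def)
  have profit: "(\<Sum>j\<in>T. profit (knapsack_of I (dss_weights I) B) j) = neg_log (\<Prod>j\<in>T. misind I j)"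
    if "T \<subseteq> set (stores I)" for T
  proof -
    have "neg_log (\<Prod>j\<in>T. misind I j) = (\<Sum>j\<in>T. neg_log (misind I j))"
      by (rule neg_log_prod) (use that nonneg in auto)
    then show ?thesis
      using that by (auto simp: knapsack_of_def result_compute_weights intro!: sum.cong)
  qed
  have "neg_log (\<Prod>j\<in>S'. misind I j) \<le> neg_log (\<Prod>j\<in>S. misind I j)"
    unfolding profit[OF S, symmetric] profit[OF S'(1), symmetric]
    using opt S' by (simp add: knapsack_optimal_def knapsack_feasible_of_dss_iff)
  moreover have "0 \<le> (\<Prod>j\<in>T. misind I j)" if "T \<subseteq> set (stores I)" for T
    by (rule prod_nonneg) (use that nonneg in auto)
  ultimately show ?thesis
    using S S'(1) by (simp add: neg_log_le_iff)
qed

text \<open>Integrality of the costs lets the exact cost of a set serve as a Knapsack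
  budget.\<close>

lemma sum_acc_cost_nat:
  assumes "dss_instance I" "integer_costs I" "D \<subseteq> set (stores I)"
  obtains C :: nat where "(\<Sum>j\<in>D. acc_cost I j) = real C"
proof -
  have "(\<Sum>j\<in>D. acc_cost I j) \<in> \<int>"
    by (rule Ints_sum) (use assms in \<open>auto simp: integer_costs_def\<close>)
  moreover have "0 \<le> (\<Sum>j\<in>D. acc_cost I j)"
    by (rule sum_nonneg) (use assms in \<open>force simp: dss_instance_def\<close>)
  ultimately have "(\<Sum>j\<in>D. acc_cost I j) \<in> \<nat>"
    by (simp add: Nats_altdef2)
  then show thesis
    using that by (auto elim: Nats_cases)
qed

lemma exists_budget_phi_le:
  assumes I: "dss_instance I" "integer_costs I"
    and opt: "\<And>B. knapsack_optimal (knapsack_of I (dss_weights I) B) (R B)"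
    and D: "D \<subseteq> set (stores I)"
  shows "\<exists>B. real B \<le> max_budget I \<and> phi I (R B) \<le> phi I D"
proof -
  have cost: "1 \<le> acc_cost I j" if "j \<in> set (stores I)" for j
    using I that by (auto simp: dss_instance_def)
  have penalty: "1 \<le> penalty I"
    using I by (simp add: dss_instance_def)
  have feas: "R B \<subseteq> set (stores I)" "(\<Sum>j\<in>R B. acc_cost I j) \<le> real B" for B
    using opt[of B] by (auto simp: knapsack_optimal_def knapsack_feasible_of_dss_iff)
  obtain C where C: "(\<Sum>j\<in>D. acc_cost I j) = real C"
    using sum_acc_cost_nat I D by blast
  show ?thesis
  proof (cases "real C \<le> max_budget I")
    case True
    \<comment> \<open>At the budget \<open>C\<close> that \<open>D\<close> uses up,
      \<open>R C\<close> is no worse than \<open>D\<close> in either summand of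
      \<open>phi\<close>.\<close>
    have "(\<Prod>j\<in>R C. misind I j) \<le> (\<Prod>j\<in>D. misind I j)"
      using knapsack_optimal_min_prod[OF I(1) opt D] C by simp
    then have "phi I (R C) \<le> phi I D"
      using feas(2)[of C] C penalty by (simp add: phi_def add_mono mult_left_mono)
    then show ?thesis using True by blast
  next
    case False
    \<comment> \<open>No set of stores costs more than all of them, so a cost above the minimum must
      exceed the penalty.\<close>
    have "real C \<le> (\<Sum>j\<in>set (stores I). acc_cost I j)"
      unfolding C[symmetric] by (rule sum_mono2) (use D cost in force)+
    then have "penalty I < real C"
      using False by (auto simp: max_budget_def)
    \<comment> \<open>Every store costs at least 1, so budget 0 admits only the empty set, whose
      expected cost is the penalty.\<close>
    moreover have "R 0 = {}"
    proof (rule ccontr)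
      assume "R 0 \<noteq> {}"
      moreover have "finite (R 0)"
        using feas(1)[of 0] by (rule finite_subset) simp
      moreover have "0 < acc_cost I j" if "j \<in> R 0" for j
        using cost[of j] feas(1)[of 0] that by auto
      ultimately have "0 < (\<Sum>j\<in>R 0. acc_cost I j)"
        by (intro sum_pos)
      then show False using feas(2)[of 0] by simp
    qed
    moreover have "0 \<le> (\<Prod>j\<in>D. misind I j)"
      by (rule prod_nonneg) (use I D in \<open>auto simp: dss_instance_def\<close>)
    ultimately have "phi I (R 0) \<le> phi I D"
      using penalty C by (simp add: phi_def add_increasing2)
    moreover have "0 \<le> max_budget I"
      using penalty cost by (force simp: max_budget_def intro: sum_nonneg)
    ultimately show ?thesis by (intro exI[of _ 0]) simp
  qed
qed

lemma ds_pp_optimal: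
  assumes A: "\<And>K. knapsack_instance K \<Longrightarrow>
      distinct (result (A K)) \<and> knapsack_optimal K (set (result (A K)))"
    and I: "dss_instance I" "integer_costs I"
  shows "dss_optimal I (set (result (ds_pp A I)))"
proof -
  let ?w = "dss_weights I"
  define R where "R B = set (result (A (knapsack_of I ?w B)))" for B
  define E where "E = set (result (ds_pp A I))"
  note A_of_dss = A[OF knapsack_instance_of_dss[OF I]]
  have opt: "knapsack_optimal (knapsack_of I ?w B) (R B)" for B
    using A_of_dss by (simp add: R_def)
  define D0 where "D0 = result (A (knapsack_of I ?w 0))"
  have "distinct (stores I)"
    using I by (simp add: dss_instance_def)
  moreover have "result (compute_phi I D0) = phi I (set D0)"
    unfolding D0_def by (rule result_compute_phi) (use A_of_dss in blast)
  ultimately have "E = set (result (ds_loop A I ?w (max_budget I) 1 (D0, phi I (set D0))))"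
    by (simp add: E_def ds_pp_def result_compute_max_budget D0_def)
  then have loop: "(E = set D0 \<or> E \<in> range R) \<and> phi I E \<le> phi I (set D0) \<and>
      (\<forall>B\<ge>1. real B \<le> max_budget I \<longrightarrow> phi I E \<le> phi I (R B))"
    using result_ds_loop[of A I ?w "phi I (set D0)" D0 "max_budget I" 1] A_of_dss
    by (simp add: R_def[abs_def])
  have R0: "set D0 = R 0" by (simp add: D0_def R_def)
  have "phi I E \<le> phi I D" if D: "D \<subseteq> set (stores I)" for D
  proof -
    obtain B where B: "real B \<le> max_budget I" "phi I (R B) \<le> phi I D"
      using exists_budget_phi_le[OF I opt D] by blast
    \<comment> \<open>Budget 0 is covered by the initial candidate, all others by the loop, which
      starts at 1.\<close>
    have "phi I E \<le> phi I (R B)"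
      using loop R0 B(1) by (cases "B = 0") auto
    then show ?thesis using B(2) by linarith
  qed
  moreover have "E \<subseteq> set (stores I)"
    using loop R0 opt by (auto simp: knapsack_optimal_def knapsack_feasible_of_dss_iff)
  ultimately show ?thesis
    by (simp add: dss_optimal_def E_def)
qed

section \<open>Running time\<close>

lemma steps_ds_pp_le:
  fixes A :: "'a knapsack \<Rightarrow> 'a list timed"
  assumes A: "\<And>K. knapsack_instance K \<Longrightarrow>
      distinct (result (A K)) \<and> knapsack_optimal K (set (result (A K)))"
    and time: "\<And>K. knapsack_instance K \<Longrightarrow>
      real (steps (A K)) \<le> c * real (max 1 (length (items K)) * max 1 (budget K))"
    and c: "0 \<le> c"
    and I: "dss_instance I" "integer_costs I"
  shows "real (steps (ds_pp A I)) \<le>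
    (2 * c + 28) * real (max 1 (length (stores I))) * (max 1 (max_budget I))\<^sup>2"
proof -
  let ?w = "dss_weights I"
  define n where "n = real (max 1 (length (stores I)))"
  define m where "m = max 1 (max_budget I)"
  \<comment> \<open>The \<open>c\<close> pays for the Knapsack call, the 8 for evaluating
    \<open>phi\<close> in at most 4 + 4 \<open>n\<close> steps.\<close>
  define T where "T = (c + 8) * (n * m)"
  have n: "1 \<le> n" "real (length (stores I)) \<le> n" and m: "1 \<le> m" "max_budget I \<le> m"
    by (auto simp: n_def m_def)
  have nm: "n \<le> n * m" using n m by simp
  have nm2: "n * m \<le> n * m\<^sup>2"
    using n m by (simp add: power2_eq_square)
  note A_of_dss = A[OF knapsack_instance_of_dss[OF I]]
  have budget_time: "real (steps (A (knapsack_of I ?w B)))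
      + real (steps (compute_phi I (result (A (knapsack_of I ?w B))))) \<le> T"
    if "real B \<le> m" for B
  proof -
    have "real (steps (A (knapsack_of I ?w B))) \<le> c * (n * real (max 1 B))"
      using time[OF knapsack_instance_of_dss[OF I, of B]] by (simp add: n_def knapsack_of_def)
    also have "\<dots> \<le> c * (n * m)"
      using that c n m by (intro mult_left_mono) auto
    finally have 1: "real (steps (A (knapsack_of I ?w B))) \<le> c * (n * m)" .
    \<comment> \<open>Being duplicate-free and feasible, the output is no longer than the list of
      stores; this bounds the time for \<open>phi\<close>.\<close>
    have "length (result (A (knapsack_of I ?w B))) = card (set (result (A (knapsack_of I ?w B))))"
      using A_of_dss[of B] by (simp add: distinct_card)
    also have "\<dots> \<le> card (set (stores I))"
      using A_of_dss[of B]
      by (intro card_mono) (auto simp: knapsack_optimal_def knapsack_feasible_of_dss_iff)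
    also have "\<dots> \<le> length (stores I)"
      by (rule card_length)
    finally have "real (steps (compute_phi I (result (A (knapsack_of I ?w B))))) \<le> 8 * n"
      using n by (simp add: steps_compute_phi)
    with 1 nm show ?thesis by (simp add: T_def algebra_simps)
  qed
  define D0 where "D0 = result (A (knapsack_of I ?w 0))"
  define v0 where "v0 = result (compute_phi I D0)"
  have T: "0 \<le> T" using c n m by (simp add: T_def)
  have "real (steps (ds_loop A I ?w (max_budget I) 1 (D0, v0)))
      \<le> 1 + real (nat (\<lfloor>max_budget I\<rfloor> + 1 - int 1)) * (T + 3)"
    by (rule steps_ds_loop) (use budget_time m in auto)
  \<comment> \<open>Starting at budget 1 leaves at most \<lfloor>M\<rfloor> iterations, hence at
    most \<open>m\<close>.\<close>
  also have "\<dots> \<le> 1 + m * (T + 3)"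
    using m T by (intro add_mono mult_right_mono) linarith+
  finally have loop: "real (steps (ds_loop A I ?w (max_budget I) 1 (D0, v0))) \<le> 1 + m * (T + 3)" .
  have "steps (ds_pp A I) = 3 + 5 * length (stores I)
      + (steps (A (knapsack_of I ?w 0)) + steps (compute_phi I D0))
      + steps (ds_loop A I ?w (max_budget I) 1 (D0, v0))"
    using I by (simp add: ds_pp_def result_compute_max_budget steps_compute_max_budget
        steps_compute_weights D0_def v0_def dss_instance_def)
  moreover have "real (steps (A (knapsack_of I ?w 0))) + real (steps (compute_phi I D0)) \<le> T"
    using budget_time[of 0] m by (simp add: D0_def)
  ultimately have "real (steps (ds_pp A I)) \<le> 3 + 5 * n + T + (1 + m * (T + 3))"
    using loop n(2) by simp
  also have "\<dots> = 4 + 5 * n + 3 * m + (c + 8) * (n * m) + (c + 8) * (n * m\<^sup>2)"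
    by (simp add: T_def algebra_simps power2_eq_square)
  \<comment> \<open>Since \<open>n\<close> and \<open>m\<close> are at least 1, each term is
    absorbed by \<open>n * m\<^sup>2\<close>; the coefficients add up to 2 \<open>c\<close> +
    28.\<close>
  also have "\<dots> \<le> 4 * (n * m\<^sup>2) + 5 * (n * m\<^sup>2) + 3 * (n * m\<^sup>2) + (c + 8) * (n * m\<^sup>2) + (c + 8) * (n * m\<^sup>2)"
  proof -
    have "m \<le> n * m" using n m by simp
    moreover have "(c + 8) * (n * m) \<le> (c + 8) * (n * m\<^sup>2)"
      using mult_left_mono[OF nm2, of "c + 8"] c by linarith
    ultimately show ?thesis using nm nm2 n by linarith
  qed
  also have "\<dots> = (2 * c + 28) * n * m\<^sup>2"
    by (simp add: algebra_simps)
  finally show ?thesis by (simp add: n_def m_def)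
qed

text \<open>Both arguments of the minimum are at least 1 once there is a store; this removes the
  maxima from the time bound.\<close>

lemma max_budget_ge_1:
  assumes "dss_instance I" "stores I \<noteq> []"
  shows "1 \<le> max_budget I"
proof -
  obtain j where j: "j \<in> set (stores I)"
    using assms(2) by (cases "stores I") auto
  have cost: "1 \<le> acc_cost I i" if "i \<in> set (stores I)" for i
    using assms that by (auto simp: dss_instance_def)
  have "acc_cost I j \<le> (\<Sum>i\<in>set (stores I). acc_cost I i)"
    using j by (rule member_le_sum) (use cost in force)+
  then show ?thesis
    using assms cost[OF j] by (simp add: max_budget_def dss_instance_def)
qed

theorem theorem16:
  fixes A_Knap :: "'a knapsack \<Rightarrow> 'a list timed"
  assumes "optimal_knapsack_alg_nB A_Knap"
  shows "(\<forall>I. dss_instance I \<and> integer_costs I \<longrightarrow>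
            dss_optimal I (set (result (ds_pp A_Knap I)))) \<and>
         (\<lambda>I. real (steps (ds_pp A_Knap I)))
           \<in> O[principal {I. dss_instance I \<and> integer_costs I \<and> stores I \<noteq> []}](
               \<lambda>I. real (length (stores I)) * (max_budget I)\<^sup>2) \<and>
         pseudo_polynomial_on {I. dss_instance I \<and> integer_costs I} (ds_pp A_Knap)"
proof -
  have A: "distinct (result (A_Knap K)) \<and> knapsack_optimal K (set (result (A_Knap K)))"
    if "knapsack_instance K" for K
    using assms that by (simp add: optimal_knapsack_alg_nB_def)
  \<comment> \<open>Eventually in a principal filter means everywhere on its set, so one constant
    serves all Knapsack instances.\<close>
  obtain c where c: "0 < c" and time: "\<And>K. knapsack_instance K \<Longrightarrow>
      real (steps (A_Knap K)) \<le> c * real (max 1 (length (items K)) * max 1 (budget K))"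
    using assms
    by (auto simp: optimal_knapsack_alg_nB_def bigo_def eventually_principal simp del: of_nat_mult)
  define c' where "c' = 2 * c + 28"
  have bound: "real (steps (ds_pp A_Knap I)) \<le>
      c' * real (max 1 (length (stores I))) * (max 1 (max_budget I))\<^sup>2"
    if "dss_instance I" "integer_costs I" for I
    unfolding c'_def by (rule steps_ds_pp_le[OF A time]) (use c that in auto)
  \<comment> \<open>Without stores the right-hand side would be 0, although the algorithm still
    takes steps.\<close>
  have "real (steps (ds_pp A_Knap I)) \<le> c' * norm (real (length (stores I)) * (max_budget I)\<^sup>2)"
    if "dss_instance I" "integer_costs I" "stores I \<noteq> []" for I
  proof -
    have "max 1 (length (stores I)) = length (stores I)"
      using that(3) by (cases "stores I") auto
    then show ?thesis
      using bound[OF that(1,2)] max_budget_ge_1[OF that(1,3)] by (simp add: mult.assoc max_absorb2)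
  qed
  then have "(\<lambda>I. real (steps (ds_pp A_Knap I)))
      \<in> O[principal {I. dss_instance I \<and> integer_costs I \<and> stores I \<noteq> []}](
          \<lambda>I. real (length (stores I)) * (max_budget I)\<^sup>2)"
    by (intro bigoI[where c = c']) (auto simp: eventually_principal)
  \<comment> \<open>The exponent is 3 because the bound has three factors, \<open>n\<close>,
    \<open>M\<close> and \<open>M\<close>, and \<open>M\<close> is at most the penalty. The empty
    list is included, as the number of inputs and the penalty are at least 1.\<close>
  moreover have "real (steps (ds_pp A_Knap I))
      \<le> c' * norm ((real (2 * length (stores I) + 1) * max_number I) ^ 3)"
    if I: "dss_instance I" "integer_costs I" for I
  proof -
    define n where "n = real (2 * length (stores I) + 1)"
    define x where "x = max_number I"
    have "penalty I \<le> x" by (simp add: x_def max_number_def)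
    then have x: "1 \<le> x" "max 1 (max_budget I) \<le> x"
      using I by (auto simp: dss_instance_def max_budget_def)
    have n: "1 \<le> n" "real (max 1 (length (stores I))) \<le> n"
      by (auto simp: n_def)
    have "n \<le> n * x" "x \<le> n * x" using n x by simp_all
    then have "real (max 1 (length (stores I))) * (max 1 (max_budget I))\<^sup>2 \<le> (n * x) * (n * x)\<^sup>2"
      using n x \<open>n \<le> n * x\<close> \<open>x \<le> n * x\<close> by (intro mult_mono power_mono zero_le_power2) linarith+
    also have "\<dots> = (n * x) ^ 3"
      by (simp add: power2_eq_square power3_eq_cube)
    finally have "c' * (real (max 1 (length (stores I))) * (max 1 (max_budget I))\<^sup>2)
        \<le> c' * (n * x) ^ 3"
      using c by (intro mult_left_mono) (auto simp: c'_def)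
    then have "real (steps (ds_pp A_Knap I)) \<le> c' * (n * x) ^ 3"
      using bound[OF I] by (simp add: mult.assoc)
    moreover have "norm ((n * x) ^ 3) = (n * x) ^ 3" using n x by simp
    ultimately show ?thesis unfolding n_def x_def by simp
  qed
  then have "pseudo_polynomial_on {I. dss_instance I \<and> integer_costs I} (ds_pp A_Knap)"
    unfolding pseudo_polynomial_on_def
    by (intro exI[of _ 3] bigoI[where c = c']) (auto simp: eventually_principal)
  ultimately show ?thesis
    using ds_pp_optimal[OF A] by blast
qed

end
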